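(* Let $N\ge 2$. For $\phi\in[-\pi,\pi)$ and $\theta\in[0,\frac{\pi}{2}]$ let $|\Psi_\phi^\theta\rangle=\cos\theta\,|0\rangle^{\otimes N}+e^{i\phi}\sin\theta\,|1\rangle^{\otimes N}\in(\mathbb{C}^2)^{\otimes N}$ and $$\mathcal{W}_{\Psi_\phi^\theta}=\max\{\cos^2\theta,\sin^2\theta\}\,\mathbb{I}-|\Psi_\phi^\theta\rangle\langle\Psi_\phi^\theta| .$$ Then the whole family $\{\mathcal{W}_{\Psi_\phi^\theta}\}_{\phi,\theta}$ can be realized with the same (independent of $\phi,\theta$) $N+2$ local measurement settings, namely $\sigma_z^{\otimes N}$ and $$\mathcal{M}_{\theta_k}=\left(\cos\theta_k\,\sigma_x+\sin\theta_k\,\sigma_y\right)^{\otimes N},\qquad \theta_k=\frac{k\pi}{N+1},\quad k=0,1,\dots,N .$$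
   Context: The Hilbert space is that of $N$ qubits, $(\mathbb{C}^2)^{\otimes N}$, with computational basis built from $|0\rangle,|1\rangle$; $\sigma_x,\sigma_y,\sigma_z$ are the Pauli matrices and $\mathbb{I}$ is the identity. The angles $\theta_k$ are fixed and unrelated to the state parameter $\theta$. Local measurement setting (LMS): for single-qubit Hermitian operators $O_1,\dots,O_N$, each with eigenvalues $\pm1$, the LMS $O_1\otimes\cdots\otimes O_N$ means measuring each qubit $j$ in the eigenbasis of $O_j$ and recording all $N$ outcomes. Its outcome probabilities on a state $\rho$ are $\mathrm{Tr}(\Pi_a\rho)$, where for $a=(a_1,\dots,a_N)\in\{\pm1\}^N$, $\Pi_a=\bigotimes_{j=1}^N\frac{\mathbb{I}+a_jO_j}{2}$. A Hermitian operator $\mathcal{W}$ is realized with a given finite collection of LMSs if it is a real linear combination of the projectors $\Pi_a$ belonging to the settings in the collection (so that, for every state $\rho$, $\mathrm{Tr}(\mathcal{W}\rho)$ is obtained by linear postprocessing of the outcome probabilities of these settings). A family of operators is realized with the collection if each member is, the coefficients being allowed to depend on the member. *)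

theory Defs
  imports "HOL-Analysis.Analysis"
begin

text \<open>
  A qubit is \<open>complex^bool\<close>, where the index \<open>False\<close> stands for \<open>|0\<rangle>\<close> and \<open>True\<close> for \<open>|1\<rangle>\<close>.
  The qubits are labelled by a finite type \<open>'n\<close>, so \<open>N = CARD('n)\<close>.  The space of \<open>N\<close> qubits
  is \<open>complex^('n \<Rightarrow> bool)\<close>: its coordinates are indexed by the bit strings
  \<open>b :: 'n \<Rightarrow> bool\<close>, which label the product basis vectors.
\<close>

type_synonym qubit_op = "complex^bool^bool"
type_synonym 'n state = "complex^('n \<Rightarrow> bool)"
type_synonym 'n operator = "complex^('n \<Rightarrow> bool)^('n \<Rightarrow> bool)"

definition ket0 :: "complex^bool" where
  "ket0 = axis False 1"

definition ket1 :: "complex^bool" where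
  "ket1 = axis True 1"

text \<open>Tensor products of vectors and of operators, in coordinates of the product basis.\<close>

definition tensor_vec :: "('n::finite \<Rightarrow> complex^bool) \<Rightarrow> 'n state" where
  "tensor_vec v = (\<chi> b. \<Prod>j\<in>UNIV. v j $ b j)"

definition tensor_op :: "('n::finite \<Rightarrow> qubit_op) \<Rightarrow> 'n operator" where
  "tensor_op A = (\<chi> b c. \<Prod>j\<in>UNIV. A j $ b j $ c j)"

text \<open>The \<open>2 \<times> 2\<close> matrix with rows \<open>(p, q)\<close> and \<open>(r, s)\<close>, in the order \<open>|0\<rangle>\<close>, \<open>|1\<rangle>\<close>.\<close>

definition mat2 :: "complex \<Rightarrow> complex \<Rightarrow> complex \<Rightarrow> complex \<Rightarrow> qubit_op" where
  "mat2 p q r s = (\<chi> i j. if i then (if j then s else r) else (if j then q else p))"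

definition sigma_x :: qubit_op where
  "sigma_x = mat2 0 1 1 0"

definition sigma_y :: qubit_op where
  "sigma_y = mat2 0 (- \<i>) \<i> 0"

definition sigma_z :: qubit_op where
  "sigma_z = mat2 1 0 0 (- 1)"

definition hermitian :: "complex^'m^'m \<Rightarrow> bool" where
  "hermitian A \<longleftrightarrow> (\<forall>i j. A $ i $ j = cnj (A $ j $ i))"

definition eigenvalues :: "complex^'m^'m \<Rightarrow> complex set" where
  "eigenvalues A = {l. \<exists>v. v \<noteq> 0 \<and> A *v v = l *s v}"

definition outer :: "complex^'m \<Rightarrow> complex^'m \<Rightarrow> complex^'m^'m" where
  "outer v w = (\<chi> i j. v $ i * cnj (w $ j))"

text \<open>
  A local measurement setting \<open>O\<^sub>1 \<otimes> \<dots> \<otimes> O\<^sub>N\<close> is given by the family of its local observables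
  (the product operator alone would not determine the recorded local outcomes).
\<close>

definition local_setting :: "('n::finite \<Rightarrow> qubit_op) \<Rightarrow> bool" where
  "local_setting S \<longleftrightarrow> (\<forall>j. hermitian (S j) \<and> eigenvalues (S j) = {1, - 1})"

definition outcome_projector :: "('n::finite \<Rightarrow> qubit_op) \<Rightarrow> ('n \<Rightarrow> real) \<Rightarrow> 'n operator" where
  "outcome_projector S a = tensor_op (\<lambda>j. (1 / 2) *\<^sub>R (mat 1 + a j *\<^sub>R S j))"

text \<open>Here \<open>span\<close> is the span over the reals, so the coefficients are real.\<close>

definition realized_with :: "('n::finite \<Rightarrow> qubit_op) set \<Rightarrow> 'n operator \<Rightarrow> bool" where
  "realized_with \<S> W \<longleftrightarrow>
     finite \<S> \<and> (\<forall>S\<in>\<S>. local_setting S) \<and> hermitian W \<and>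
     W \<in> span {outcome_projector S a | S a. S \<in> \<S> \<and> (\<forall>j. a j \<in> {1, - 1})}"

definition ghz_like :: "real \<Rightarrow> real \<Rightarrow> ('n::finite) state" where
  "ghz_like \<phi> \<theta> =
     complex_of_real (cos \<theta>) *s tensor_vec (\<lambda>_. ket0) +
     (exp (\<i> * complex_of_real \<phi>) * complex_of_real (sin \<theta>)) *s tensor_vec (\<lambda>_. ket1)"

definition ghz_witness :: "real \<Rightarrow> real \<Rightarrow> ('n::finite) operator" where
  "ghz_witness \<phi> \<theta> =
     max ((cos \<theta>)\<^sup>2) ((sin \<theta>)\<^sup>2) *\<^sub>R mat 1 - outer (ghz_like \<phi> \<theta>) (ghz_like \<phi> \<theta>)"

definition z_setting :: "'n::finite \<Rightarrow> qubit_op" where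
  "z_setting = (\<lambda>_. sigma_z)"

definition xy_setting :: "real \<Rightarrow> 'n::finite \<Rightarrow> qubit_op" where
  "xy_setting t = (\<lambda>_. cos t *\<^sub>R sigma_x + sin t *\<^sub>R sigma_y)"

end

theory Submission imports Defs begin

text \<open>
  The diagonal part of the witness is a real combination of the projectors of the setting
  \<open>\<sigma>\<^sub>z\<close>.  Writing \<open>m\<close> for the number of ones in \<open>b\<close>, the only non-zero entry in row \<open>b\<close> of the
  \<open>N\<close>-fold tensor power of \<open>cos t \<sigma>\<^sub>x + sin t \<sigma>\<^sub>y\<close> is \<open>cis (t (2 m - N))\<close>, in the column
  of the complement of \<open>b\<close>.  At the angles \<open>k \<pi> / (N + 1)\<close> these phases form, up to a factor
  independent of \<open>m\<close>, the discrete Fourier basis of order \<open>N + 1\<close>, so Fourier inversion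
  isolates the corners \<open>m = 0\<close> and \<open>m = N\<close>.  The coefficients
  \<open>2 cos (N t\<^sub>k - \<phi>) / (N + 1)\<close> are real because the two corners are complex conjugates.
\<close>

subsection \<open>Local settings\<close>

text \<open>Squaring gives \<open>l * l = 1\<close> for every eigenvalue. Conversely,
  \<open>A *v x + x\<close> is fixed and \<open>A *v y - y\<close> is negated by \<open>A\<close>;
  they are nonzero for suitable \<open>x\<close> and \<open>y\<close> because \<open>A\<close> is
  neither \<open>- mat 1\<close> nor \<open>mat 1\<close>.\<close>

lemma eigenvalues_involution:
  fixes A :: "complex^'m^'m"
  assumes inv: "A ** A = mat 1" and "A \<noteq> mat 1" "A \<noteq> - mat 1"
  shows "eigenvalues A = {1, - 1}"
proof
  show "eigenvalues A \<subseteq> {1, - 1}"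
  proof
    fix l assume "l \<in> eigenvalues A"
    then obtain v where v: "v \<noteq> 0" "A *v v = l *s v"
      by (auto simp: eigenvalues_def)
    have "v = A *v (A *v v)"
      by (simp add: matrix_vector_mul_assoc inv)
    also have "\<dots> = l *s (l *s v)"
      by (simp add: v vector_scalar_commute)
    finally have "(l * l - 1) *s v = 0"
      by (simp add: vec_eq_iff algebra_simps)
    with v have "l * l = 1"
      by (simp only: vector_mul_eq_0) simp
    then show "l \<in> {1, - 1}"
      by (simp add: square_eq_1_iff)
  qed
  have "\<exists>x. A *v x \<noteq> - x"
  proof (rule ccontr)
    assume "\<nexists>x. A *v x \<noteq> - x"
    then have "A *v x = (- mat 1) *v x" for x
      by (simp add: vec_eq_iff matrix_vector_mult_def mat_def sum_negf if_distrib
          if_distribR cong: if_cong)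
    with assms show False
      by (metis matrix_eq)
  qed
  then obtain x where x: "A *v x \<noteq> - x" ..
  have "\<exists>x. A *v x \<noteq> x"
    using assms by (metis matrix_eq matrix_vector_mul_lid)
  then obtain y where y: "A *v y \<noteq> y" ..
  have "A *v (A *v x + x) = 1 *s (A *v x + x)" "A *v (A *v y - y) = (- 1) *s (A *v y - y)"
    by (simp_all add: matrix_vector_mul_assoc inv matrix_vector_right_distrib
        matrix_vector_mult_diff_distrib)
  moreover have "A *v x + x \<noteq> 0" "A *v y - y \<noteq> 0"
    using x y by (auto simp: eq_neg_iff_add_eq_0)
  ultimately show "{1, - 1} \<subseteq> eigenvalues A"
    unfolding eigenvalues_def by blast
qed

lemma local_setting_z: "local_setting z_setting"
proof -
  have "eigenvalues sigma_z = {1, - 1}"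
    by (rule eigenvalues_involution)
      (auto simp: sigma_z_def mat2_def mat_def matrix_matrix_mult_def vec_eq_iff UNIV_bool)
  then show ?thesis
    by (auto simp: local_setting_def z_setting_def hermitian_def sigma_z_def mat2_def)
qed

lemma xy_setting_nth:
  "xy_setting t j $ p $ q = (if p = q then 0 else cis (if p then t else - t))"
  by (auto simp: xy_setting_def sigma_x_def sigma_y_def mat2_def complex_eq_iff)

lemma local_setting_xy: "local_setting (xy_setting t)"
proof -
  have "eigenvalues (xy_setting t j) = {1, - 1}" for j :: 'a
    by (rule eigenvalues_involution)
      (auto simp: xy_setting_nth mat_def matrix_matrix_mult_def vec_eq_iff UNIV_bool cis_mult)
  then show ?thesis
    by (auto simp: local_setting_def hermitian_def xy_setting_nth cis_cnj)
qed

text \<open>Serves the count of settings: the upper left entry is 1 for \<open>sigma_z\<close> and 0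
  for every observable in the x-y plane.\<close>

lemma z_setting_neq_xy_setting: "z_setting \<noteq> (xy_setting t :: 'n::finite \<Rightarrow> qubit_op)"
proof
  assume eq: "z_setting = (xy_setting t :: 'n \<Rightarrow> qubit_op)"
  have "z_setting (undefined :: 'n) $ False $ False = 1"
    by (simp add: z_setting_def sigma_z_def mat2_def)
  then show False
    unfolding eq by (simp add: xy_setting_nth)
qed

text \<open>The lower left entry is \<open>cis t\<close>, and its real part alone separates angles
  in a half turn.\<close>

lemma xy_setting_inj_on: "inj_on (xy_setting :: real \<Rightarrow> 'n::finite \<Rightarrow> qubit_op) {0..pi}"
proof (rule inj_onI)
  fix s t :: real
  assume st: "s \<in> {0..pi}" "t \<in> {0..pi}"
    and eq: "xy_setting s = (xy_setting t :: 'n \<Rightarrow> qubit_op)"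
  have "cis s = xy_setting s (undefined :: 'n) $ True $ False"
    by (simp add: xy_setting_nth)
  also have "\<dots> = cis t"
    unfolding eq by (simp add: xy_setting_nth)
  finally have "cos s = cos t"
    by (simp add: complex_eq_iff)
  with st show "s = t"
    by (simp add: cos_inj_pi)
qed

text \<open>Each factor splits as \<open>S j = (1 + S j)/2 - (1 - S j)/2\<close>. Multiplying out
  over the qubits leaves one term per sign pattern, weighted by the product of the outcomes.\<close>

lemma tensor_op_eq_sum_outcome_projectors:
  fixes S :: "'n::finite \<Rightarrow> qubit_op"
  shows "tensor_op S =
    (\<Sum>a\<in>(UNIV \<rightarrow>\<^sub>E {1, - 1}). (\<Prod>j\<in>UNIV. a j) *\<^sub>R outcome_projector S a)"
proof -
  have "(\<Sum>a\<in>(UNIV \<rightarrow>\<^sub>E {1, - 1}). (\<Prod>j\<in>UNIV. a j) *\<^sub>R outcome_projector S a) $ b $ c =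
    tensor_op S $ b $ c" for b c
  proof -
    let ?f = "\<lambda>j (y::real). y *\<^sub>R ((1 / 2) *\<^sub>R (mat 1 + y *\<^sub>R S j)) $ b j $ c j"
    have "(\<Prod>j\<in>UNIV. \<Sum>y\<in>{1, - 1}. ?f j y) = (\<Sum>a\<in>(UNIV \<rightarrow>\<^sub>E {1, - 1}). \<Prod>j\<in>UNIV. ?f j (a j))"
      by (rule prod_sum_PiE) auto
    moreover have "(\<Sum>y\<in>{1, - 1}. ?f j y) = S j $ b j $ c j" for j
      by (simp add: complex_eq_iff field_simps)
    moreover have "(\<Prod>j\<in>UNIV. ?f j (a j)) = ((\<Prod>j\<in>UNIV. a j) *\<^sub>R outcome_projector S a) $ b $ c" for a
      by (simp add: outcome_projector_def tensor_op_def scaleR_conv_of_real[where 'a = complex] flip: prod.distrib)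
    ultimately show ?thesis
      by (simp add: tensor_op_def)
  qed
  then show ?thesis
    by (simp add: vec_eq_iff)
qed

lemma tensor_op_in_span:
  fixes S :: "'n::finite \<Rightarrow> qubit_op"
  assumes "S \<in> \<S>"
  shows "tensor_op S \<in> span {outcome_projector S a | S a. S \<in> \<S> \<and> (\<forall>j. a j \<in> {1, - 1})}"
  unfolding tensor_op_eq_sum_outcome_projectors
  using assms by (intro span_sum span_scale span_base) (auto simp: PiE_iff)

text \<open>\<open>False\<close> labels the +1 eigenvector of \<open>sigma_z\<close>, so a set bit
  means outcome -1; the product of the local projectors is a diagonal matrix unit.\<close>

lemma outcome_projector_z:
  "outcome_projector z_setting (\<lambda>j. if b j then - 1 else 1) =
    (\<chi> c d. if c = b \<and> d = b then 1 else 0)"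
proof -
  have "((1 / 2) *\<^sub>R (mat 1 + (if b j then - 1 else 1 :: real) *\<^sub>R sigma_z)) $ c j $ d j =
      (if c j = b j \<and> d j = b j then 1 else 0)" for c d j
    by (auto simp: mat_def sigma_z_def mat2_def scaleR_conv_of_real[where 'a = complex])
  moreover have "(\<Prod>j\<in>UNIV. if c j = b j \<and> d j = b j then 1 else 0 :: complex) =
      (if c = b \<and> d = b then 1 else 0)" for c d
    by (auto simp: fun_eq_iff)
  ultimately show ?thesis
    by (simp add: outcome_projector_def tensor_op_def z_setting_def vec_eq_iff)
qed

text \<open>Diagonal matrix units are outcome projectors of \<open>z_setting\<close>, so the entries
  \<open>d b\<close> themselves serve as real coefficients.\<close>

lemma diagonal_in_span:
  fixes d :: "('n::finite \<Rightarrow> bool) \<Rightarrow> real"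
  assumes "z_setting \<in> \<S>"
  shows "(\<chi> b c. if b = c then of_real (d b) else 0) \<in>
    span {outcome_projector S a | S a. S \<in> \<S> \<and> (\<forall>j. a j \<in> {1, - 1})}"
proof -
  have "(\<chi> b c. if b = c then of_real (d b) else 0) =
    (\<Sum>b\<in>UNIV. d b *\<^sub>R outcome_projector z_setting (\<lambda>j. if b j then - 1 else 1))"
  proof -
    have "(\<Sum>b'\<in>UNIV. d b' *\<^sub>R (if b = b' \<and> c = b' then 1 else 0 :: complex)) =
       (\<Sum>b'\<in>UNIV. if b' = b then (if b = c then of_real (d b) else 0) else 0)" for b c
      by (rule sum.cong) (auto simp: scaleR_conv_of_real[where 'a = complex])
    then show ?thesis
      by (simp add: outcome_projector_z vec_eq_iff)
  qed
  moreover have "outcome_projector z_setting (\<lambda>j. if b j then - 1 else 1) \<in>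
      {outcome_projector S a | S a. S \<in> \<S> \<and> (\<forall>j. a j \<in> {1, - 1})}" for b
    using assms by fastforce
  ultimately show ?thesis
    by (simp only: span_sum span_scale span_base)
qed

subsection \<open>Fourier inversion\<close>

text \<open>A geometric sum over the powers of an \<open>(N + 1)\<close>-th root of unity
  \<open>w\<close>. Order \<open>N + 1\<close> rather than \<open>N\<close> matters: it keeps
  \<open>w\<close> different from 1 even for \<open>l = N\<close>.\<close>

lemma sum_cis_roots_of_unity:
  assumes "l \<le> N"
  shows "(\<Sum>k\<le>N. cis (2 * real l * (real k * pi / (real N + 1)))) = (if l = 0 then of_nat N + 1 else 0)"
proof (cases "l = 0")
  case False
  define w where "w = cis (2 * pi * real l / real (Suc N))"
  have w: "w = exp (2 * of_real pi * \<i> * of_nat l / of_nat (Suc N))"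
    by (simp add: w_def cis_conv_exp mult_ac)
  have "\<not> Suc N dvd l"
    using False assms by (auto dest: dvd_imp_le)
  then have "w \<noteq> 1"
    unfolding w by (subst complex_root_unity_eq_1) auto
  moreover have "w ^ Suc N = 1"
    unfolding w by (rule complex_root_unity) simp
  moreover have "cis (2 * real l * (real k * pi / (real N + 1))) = w ^ k" for k
    unfolding w_def Complex.DeMoivre by (rule arg_cong[of _ _ cis]) (simp add: field_simps)
  ultimately show ?thesis
    using False geometric_sum[of w "Suc N"] by (simp add: lessThan_Suc_atMost)
qed simp

lemma sum_cos_cis:
  assumes "m \<le> N"
  shows "(\<Sum>k\<le>N. of_real (2 * cos (real N * (real k * pi / (real N + 1)) - \<phi>) / (real N + 1)) *
            cis ((2 * real m - real N) * (real k * pi / (real N + 1)))) =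
         (if m = 0 then cis (- \<phi>) else 0) + (if m = N then cis \<phi> else 0)"
proof -
  define t where "t k = real k * pi / (real N + 1)" for k
  have nz: "(of_nat N + 1 :: complex) \<noteq> 0"
    by (metis of_nat_Suc of_nat_eq_0_iff add.commute nat.distinct(1))
  have two_cos: "of_real (2 * cos x) = cis x + cis (- x)" for x
    by (simp add: complex_eq_iff)
  \<comment> \<open>The two exponentials in the cosine shift the frequency \<open>2 m - N\<close> to
    \<open>2 m\<close> and to \<open>- 2 (N - m)\<close>. Conjugation makes the second one
    nonnegative, so the root-of-unity sum applies to \<open>l = m\<close> and
    \<open>l = N - m\<close>.\<close>
  have "of_real (2 * cos (real N * t k - \<phi>) / (real N + 1)) * cis ((2 * real m - real N) * t k) =
      (cis (- \<phi>) * cis (2 * real m * t k) + cis \<phi> * cnj (cis (2 * real (N - m) * t k))) / (of_nat N + 1)"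
    for k
  proof -
    have "of_real (2 * cos (real N * t k - \<phi>)) * cis ((2 * real m - real N) * t k) =
      cis (- \<phi>) * cis (2 * real m * t k) + cis \<phi> * cnj (cis (2 * real (N - m) * t k))"
      unfolding two_cos using assms
      by (simp add: cis_mult cis_cnj of_nat_diff algebra_simps)
    then show ?thesis
      by (simp add: field_simps)
  qed
  then have "(\<Sum>k\<le>N. of_real (2 * cos (real N * t k - \<phi>) / (real N + 1)) * cis ((2 * real m - real N) * t k)) =
      (cis (- \<phi>) * (\<Sum>k\<le>N. cis (2 * real m * t k)) +
       cis \<phi> * cnj (\<Sum>k\<le>N. cis (2 * real (N - m) * t k))) / (of_nat N + 1)"
    by (simp only: sum_divide_distrib sum.distrib sum_distrib_left cnj_sum add_divide_distrib)
  also have "(\<Sum>k\<le>N. cis (2 * real m * t k)) = (if m = 0 then of_nat N + 1 else 0)"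
    unfolding t_def using assms by (rule sum_cis_roots_of_unity)
  also have "(\<Sum>k\<le>N. cis (2 * real (N - m) * t k)) = (if N - m = 0 then of_nat N + 1 else 0)"
    unfolding t_def by (rule sum_cis_roots_of_unity) simp
  also have "(cis (- \<phi>) * (if m = 0 then of_nat N + 1 else 0) +
      cis \<phi> * cnj (if N - m = 0 then of_nat N + 1 else 0)) / (of_nat N + 1) =
      (if m = 0 then cis (- \<phi>) else 0) + (if m = N then cis \<phi> else 0)"
    using assms nz by (auto simp: add_divide_distrib)
  finally show ?thesis
    by (simp only: t_def)
qed

text \<open>Every factor is off-diagonal and so flips its bit; set row bits contribute the angle
  \<open>t\<close>, the others \<open>- t\<close>.\<close>

lemma tensor_op_xy_nth:
  fixes b c :: "'n::finite \<Rightarrow> bool"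
  shows "tensor_op (xy_setting t) $ b $ c =
    (if \<forall>j. c j \<noteq> b j then cis ((2 * real (card {j. b j}) - real CARD('n)) * t) else 0)"
proof (cases "\<forall>j. c j \<noteq> b j")
  case True
  have "CARD('n) = card ({j. b j} \<union> {j. \<not> b j})"
    by (rule arg_cong[of _ _ card]) auto
  also have "\<dots> = card {j. b j} + card {j. \<not> b j}"
    by (rule card_Un_disjoint) auto
  finally have card_not: "real (card {j. \<not> b j}) = real CARD('n) - real (card {j. b j})"
    by simp
  have "(\<Prod>j\<in>UNIV. xy_setting t j $ b j $ c j) =
      (\<Prod>j\<in>UNIV. if b j then cis t else cis (- t))"
    using True by (intro prod.cong) (auto simp: xy_setting_nth)
  also have "\<dots> = cis t ^ card {j. b j} * cis (- t) ^ card {j. \<not> b j}"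
    by (simp add: prod.If_cases Compl_eq)
  also have "\<dots> = cis ((2 * real (card {j. b j}) - real CARD('n)) * t)"
    by (simp only: Complex.DeMoivre cis_mult card_not) (simp add: algebra_simps)
  finally show ?thesis
    using True by (simp add: tensor_op_def)
qed (auto simp: tensor_op_def xy_setting_nth)

subsection \<open>The witness\<close>

lemma ghz_like_nth:
  "ghz_like \<phi> \<theta> $ b = (if \<forall>j. \<not> b j then of_real (cos \<theta>) else 0) +
     (if \<forall>j. b j then cis \<phi> * of_real (sin \<theta>) else 0)"
proof -
  have "tensor_vec (\<lambda>_. ket0) $ b = (if \<forall>j. \<not> b j then 1 else 0)"
    "tensor_vec (\<lambda>_. ket1) $ b = (if \<forall>j. b j then 1 else 0)"
    by (auto simp: tensor_vec_def ket0_def ket1_def axis_def)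
  then show ?thesis
    by (auto simp: ghz_like_def cis_conv_exp)
qed

lemma hermitian_ghz_witness: "hermitian (ghz_witness \<phi> \<theta>)"
  by (auto simp: hermitian_def ghz_witness_def outer_def mat_def)

text \<open>Apart from its diagonal, the witness has only the two corner entries coupling the
  all-zeros and all-ones strings, \<open>- cos \<theta> sin \<theta>\<close> times
  \<open>cis (- \<phi>)\<close> or \<open>cis \<phi>\<close>; the Fourier sum supplies these
  phases.\<close>

lemma ghz_witness_decomposition:
  defines "t \<equiv> \<lambda>k. real k * pi / (real CARD('n) + 1)"
  shows "(ghz_witness \<phi> \<theta> :: 'n::finite operator) =
    (\<chi> b c. if b = c then of_real (max ((cos \<theta>)\<^sup>2) ((sin \<theta>)\<^sup>2) -
        (if \<forall>j. \<not> b j then (cos \<theta>)\<^sup>2 else 0) - (if \<forall>j. b j then (sin \<theta>)\<^sup>2 else 0)) else 0) -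
    (cos \<theta> * sin \<theta>) *\<^sub>R (\<Sum>k\<le>CARD('n).
        (2 * cos (real CARD('n) * t k - \<phi>) / (real CARD('n) + 1)) *\<^sub>R tensor_op (xy_setting (t k)))"
    (is "_ = ?D - _ *\<^sub>R ?F")
proof -
  have F: "?F $ b $ c = (if \<forall>j. c j \<noteq> b j then
      (if \<forall>j. \<not> b j then cis (- \<phi>) else 0) + (if \<forall>j. b j then cis \<phi> else 0) else 0)" for b c
  proof (cases "\<forall>j. c j \<noteq> b j")
    case True
    have le: "card {j. b j} \<le> CARD('n)"
      by (simp add: card_mono)
    \<comment> \<open>The values \<open>m = 0\<close> and \<open>m = N\<close> selected by Fourier
      inversion are exactly the two constant bit strings.\<close>
    have iff: "card {j. b j} = 0 \<longleftrightarrow> (\<forall>j. \<not> b j)" "card {j. b j} = CARD('n) \<longleftrightarrow> (\<forall>j. b j)"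
      by (auto dest!: card_eq_UNIV_imp_eq_UNIV[rotated])
    show ?thesis
      using sum_cos_cis[OF le, of \<phi>] True unfolding iff t_def
      by (simp add: tensor_op_xy_nth scaleR_conv_of_real[where 'a = complex])
  next
    case False
    then have "tensor_op (xy_setting x) $ b $ c = 0" for x
      by (simp only: tensor_op_xy_nth if_False)
    then show ?thesis
      unfolding if_not_P[OF False] by simp
  qed
  have "ghz_witness \<phi> \<theta> $ b $ c = (?D - (cos \<theta> * sin \<theta>) *\<^sub>R ?F) $ b $ c" for b c :: "'n \<Rightarrow> bool"
  proof -
    have D: "?D $ b $ c = (if b = c then of_real (max ((cos \<theta>)\<^sup>2) ((sin \<theta>)\<^sup>2) -
        (if \<forall>j. \<not> b j then (cos \<theta>)\<^sup>2 else 0) - (if \<forall>j. b j then (sin \<theta>)\<^sup>2 else 0)) else 0)"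
      by simp
    have W: "ghz_witness \<phi> \<theta> $ b $ c = (if b = c then of_real (max ((cos \<theta>)\<^sup>2) ((sin \<theta>)\<^sup>2)) else 0) -
        ghz_like \<phi> \<theta> $ b * cnj (ghz_like \<phi> \<theta> $ c)"
      by (simp add: ghz_witness_def outer_def mat_def scaleR_conv_of_real[where 'a = complex])
    \<comment> \<open>Rows and columns are each classified as all zeros, all ones or mixed; mixed
      strings carry no amplitude.\<close>
    consider "\<forall>j. \<not> b j" | "\<forall>j. b j" | "\<not> (\<forall>j. b j)" "\<not> (\<forall>j. \<not> b j)"
      by blast
    note b_cases = this
    consider "\<forall>j. \<not> c j" | "\<forall>j. c j" | "\<not> (\<forall>j. c j)" "\<not> (\<forall>j. \<not> c j)"
      by blast
    then show ?thesis
      unfolding W vector_minus_component vector_scaleR_component F D ghz_like_nth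
      by (cases rule: b_cases; cases)
        (auto simp: fun_eq_iff scaleR_conv_of_real[where 'a = complex] cis_cnj cis_mult power2_eq_square)
  qed
  then show ?thesis
    by (simp add: vec_eq_iff)
qed

theorem theorem2:
  fixes \<S> :: "('n::finite \<Rightarrow> qubit_op) set"
  assumes "CARD('n) \<ge> 2"
    and "\<S> = {z_setting} \<union>
           {xy_setting (real k * pi / (real CARD('n) + 1)) | k :: nat. k \<le> CARD('n)}"
  shows "card \<S> = CARD('n) + 2 \<and>
         (\<forall>S\<in>\<S>. local_setting S) \<and>
         (\<forall>\<phi>\<in>{- pi..<pi}. \<forall>\<theta>\<in>{0..pi / 2}. realized_with \<S> (ghz_witness \<phi> \<theta>))"
proof -
  define t where "t k = real k * pi / (real CARD('n) + 1)" for k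
  have S: "\<S> = insert z_setting ((\<lambda>k. xy_setting (t k)) ` {..CARD('n)})"
    using assms(2) by (auto simp: t_def)
  have "inj_on ((xy_setting :: real \<Rightarrow> 'n \<Rightarrow> qubit_op) \<circ> t) {..CARD('n)}"
  proof (rule comp_inj_on)
    show "inj_on t {..CARD('n)}"
      by (auto simp: inj_on_def t_def)
    \<comment> \<open>The denominator \<open>N + 1\<close> exceeds every \<open>k\<close>, which
      keeps the angles in the range where \<open>xy_setting\<close> is injective.\<close>
    have "t k \<le> pi" if "k \<le> CARD('n)" for k
      using mult_right_mono[of "real k / (real CARD('n) + 1)" 1 pi] that by (simp add: t_def)
    then have "t ` {..CARD('n)} \<subseteq> {0..pi}"
      by (auto simp: t_def)
    then show "inj_on (xy_setting :: real \<Rightarrow> 'n \<Rightarrow> qubit_op) (t ` {..CARD('n)})"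
      by (rule inj_on_subset[OF xy_setting_inj_on])
  qed
  then have "card ((\<lambda>k. xy_setting (t k) :: 'n \<Rightarrow> qubit_op) ` {..CARD('n)}) = CARD('n) + 1"
    by (simp add: card_image comp_def)
  then have card: "card \<S> = CARD('n) + 2"
    unfolding S using z_setting_neq_xy_setting by (subst card_insert_disjoint) auto
  have local: "\<forall>S\<in>\<S>. local_setting S"
    by (auto simp: S local_setting_z local_setting_xy)
  have "realized_with \<S> (ghz_witness \<phi> \<theta>)" for \<phi> \<theta>
    unfolding realized_with_def
  proof (intro conjI)
    show "finite \<S>"
      by (simp add: S)
    show "ghz_witness \<phi> \<theta> \<in> span {outcome_projector S a | S a. S \<in> \<S> \<and> (\<forall>j. a j \<in> {1, - 1})}"
      \<comment> \<open>The diagonal part lies in the span through \<open>z_setting\<close>, each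
        tensor power through its own \<open>xy_setting\<close>; only the real coefficients depend on
        \<open>\<phi>\<close> and \<open>\<theta>\<close>.\<close>
      unfolding ghz_witness_decomposition t_def[symmetric]
      by (intro span_diff span_scale span_sum diagonal_in_span tensor_op_in_span) (auto simp: S)
  qed (use local hermitian_ghz_witness in auto)
  with card local show ?thesis
    by blast
qed

end
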